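(* Let $T,S\in \mathcal{B}_A(\mathcal{H})$. Then $$\omega_{A,\mathrm{e}}^2(T,S) \leq \sqrt{\|T\|_A^4+\|S\|_A^4+2\,\omega_A^2(S^\sharp T)}\leq \|T\|_A^2+\|S\|_A^2 .$$
   Context: $\mathcal{H}$ is a complex Hilbert space with inner product $\langle\cdot\mid\cdot\rangle$, $\mathcal{B}(\mathcal{H})$ is the algebra of bounded linear operators on $\mathcal{H}$, and $A\in\mathcal{B}(\mathcal{H})$ is a fixed nonzero positive (semidefinite) operator. Put $\langle x\mid y\rangle_A=\langle Ax\mid y\rangle$ and $\|x\|_A=\langle x\mid x\rangle_A^{1/2}$. $\mathcal{B}_A(\mathcal{H})=\{T\in\mathcal{B}(\mathcal{H}) : \mathcal{R}(T^*A)\subseteq\mathcal{R}(A)\}$, where $\mathcal{R}$ denotes range; for $T\in\mathcal{B}_A(\mathcal{H})$, $T^\sharp$ denotes the unique $X\in\mathcal{B}(\mathcal{H})$ with $AX=T^*A$ and $\mathcal{R}(X)\subseteq\overline{\mathcal{R}(A)}$ (so $\langle Tx\mid y\rangle_A=\langle x\mid T^\sharp y\rangle_A$). For $T,S\in\mathcal{B}_A(\mathcal{H})$: $\|T\|_A=\sup\{\|Tx\|_A : \|x\|_A=1\}$, $\omega_A(T)=\sup\{|\langle Tx\mid x\rangle_A| : \|x\|_A=1\}$, and $\omega_{A,\mathrm{e}}(T,S)=\sup\{(|\langle Tx\mid x\rangle_A|^2+|\langle Sx\mid x\rangle_A|^2)^{1/2} : \|x\|_A=1\}$. All of these are finite.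 *)

theory Defs
  imports "HOL-Analysis.Analysis"
begin

class scaleC =
  fixes scaleC :: "complex \<Rightarrow> 'a \<Rightarrow> 'a"  (infixr \<open>*\<^sub>C\<close> 75)

text \<open>
  A complex inner product space carries its norm and topology through \<^class>\<open>real_normed_vector\<close>;
  the real scalar multiplication is the restriction of the complex one, and the norm is the one
  induced by the inner product. The inner product is linear in the first argument.
\<close>

class complex_inner = real_normed_vector + scaleC +
  fixes cinner :: "'a \<Rightarrow> 'a \<Rightarrow> complex"
  assumes scaleC_add_right: "c *\<^sub>C (x + y) = c *\<^sub>C x + c *\<^sub>C y"
    and scaleC_add_left: "(c + d) *\<^sub>C x = c *\<^sub>C x + d *\<^sub>C x"
    and scaleC_scaleC: "c *\<^sub>C (d *\<^sub>C x) = (c * d) *\<^sub>C x"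
    and scaleC_one: "1 *\<^sub>C x = x"
    and scaleR_scaleC: "r *\<^sub>R x = complex_of_real r *\<^sub>C x"
    and cinner_commute: "cinner x y = cnj (cinner y x)"
    and cinner_add_left: "cinner (x + y) z = cinner x z + cinner y z"
    and cinner_scaleC_left: "cinner (c *\<^sub>C x) y = c * cinner x y"
    and cinner_ge_zero: "cinner x x \<in> \<real>\<^sub>\<ge>\<^sub>0"
    and cinner_eq_zero_iff: "cinner x x = 0 \<longleftrightarrow> x = 0"
    and norm_eq_sqrt_cinner: "norm x = sqrt (Re (cinner x x))"

class complex_hilbert = complex_inner + banach

instantiation complex :: complex_hilbert
begin

definition scaleC_complex :: "complex \<Rightarrow> complex \<Rightarrow> complex"
  where "scaleC_complex c x = c * x"

definition cinner_complex :: "complex \<Rightarrow> complex \<Rightarrow> complex"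
  where "cinner_complex x y = x * cnj y"

instance
proof
  fix x :: complex
  have *: "cinner x x = complex_of_real ((norm x)\<^sup>2)"
    by (simp add: cinner_complex_def complex_norm_square del: of_real_power)
  show "cinner x x \<in> \<real>\<^sub>\<ge>\<^sub>0" unfolding * by simp
  show "cinner x x = 0 \<longleftrightarrow> x = 0" unfolding * by simp
  show "norm x = sqrt (Re (cinner x x))" unfolding * by simp
qed (simp_all add: scaleC_complex_def cinner_complex_def algebra_simps scaleR_conv_of_real)

end

definition bounded_clinear :: "('a::complex_inner \<Rightarrow> 'a) \<Rightarrow> bool"
  where "bounded_clinear T \<longleftrightarrow> bounded_linear T \<and> (\<forall>c x. T (c *\<^sub>C x) = c *\<^sub>C T x)"

definition positive_op :: "('a::complex_inner \<Rightarrow> 'a) \<Rightarrow> bool"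
  where "positive_op A \<longleftrightarrow> bounded_clinear A \<and> (\<forall>x. cinner (A x) x \<in> \<real>\<^sub>\<ge>\<^sub>0)"

text \<open>The Hilbert space adjoint; it exists for every bounded operator by the Riesz theorem.\<close>

definition cadjoint :: "('a::complex_hilbert \<Rightarrow> 'a) \<Rightarrow> 'a \<Rightarrow> 'a"
  where "cadjoint T =
    (THE X. bounded_clinear X \<and> (\<forall>x y. cinner (T x) y = cinner x (X y)))"

definition A_inner :: "('a::complex_hilbert \<Rightarrow> 'a) \<Rightarrow> 'a \<Rightarrow> 'a \<Rightarrow> complex"
  where "A_inner A x y = cinner (A x) y"

definition A_norm :: "('a::complex_hilbert \<Rightarrow> 'a) \<Rightarrow> 'a \<Rightarrow> real"
  where "A_norm A x = sqrt (Re (A_inner A x x))"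

definition A_bounded_ops :: "('a::complex_hilbert \<Rightarrow> 'a) \<Rightarrow> ('a \<Rightarrow> 'a) set"
  where "A_bounded_ops A =
    {T. bounded_clinear T \<and> range (cadjoint T \<circ> A) \<subseteq> range A}"

text \<open>
  For positive \<open>A\<close> and \<open>T\<close> in \<open>A_bounded_ops A\<close>, Douglas' theorem gives the existence of the
  operator described here; it is unique since \<open>A\<close> is injective on the closure of its range.
\<close>

definition A_sharp :: "('a::complex_hilbert \<Rightarrow> 'a) \<Rightarrow> ('a \<Rightarrow> 'a) \<Rightarrow> 'a \<Rightarrow> 'a"
  where "A_sharp A T =
    (THE X. bounded_clinear X \<and> A \<circ> X = cadjoint T \<circ> A \<and> range X \<subseteq> closure (range A))"

text \<open>
  The suprema below are taken in \<^typ>\<open>real\<close>. For positive \<open>A \<noteq> 0\<close> and operators in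
  \<open>A_bounded_ops A\<close> the sets are nonempty and bounded above.
\<close>

definition A_opnorm :: "('a::complex_hilbert \<Rightarrow> 'a) \<Rightarrow> ('a \<Rightarrow> 'a) \<Rightarrow> real"
  where "A_opnorm A T = (SUP x\<in>{x. A_norm A x = 1}. A_norm A (T x))"

definition A_numradius :: "('a::complex_hilbert \<Rightarrow> 'a) \<Rightarrow> ('a \<Rightarrow> 'a) \<Rightarrow> real"
  where "A_numradius A T = (SUP x\<in>{x. A_norm A x = 1}. cmod (A_inner A (T x) x))"

definition A_euclidean_radius ::
    "('a::complex_hilbert \<Rightarrow> 'a) \<Rightarrow> ('a \<Rightarrow> 'a) \<Rightarrow> ('a \<Rightarrow> 'a) \<Rightarrow> real"
  where "A_euclidean_radius A T S =
    (SUP x\<in>{x. A_norm A x = 1}.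
      sqrt ((cmod (A_inner A (T x) x))\<^sup>2 + (cmod (A_inner A (S x) x))\<^sup>2))"

end

theory Submission
  imports Defs
begin

text \<open>
  Fix \<open>x\<close> with \<open>A_norm A x = 1\<close>. A Bessel-type inequality for the two vectors \<open>T x\<close> and \<open>S x\<close>
  bounds the square of \<open>|\<langle>T x, x\<rangle>|\<^sup>2 + |\<langle>S x, x\<rangle>|\<^sup>2\<close> by the squared Frobenius norm of their Gram
  matrix, whose off-diagonal entry is \<open>\<langle>T x, S x\<rangle> = \<langle>S\<^sup>\<sharp> T x, x\<rangle>\<close>. The second inequality is the
  Cauchy-Schwarz bound for that entry.

  The operator \<open>S\<^sup>\<sharp>\<close> exists because \<open>A\<close> maps the closure of its range bijectively onto its range;
  its boundedness follows from Baire's theorem, the sets \<open>{y. \<parallel>S\<^sup>\<sharp> y\<parallel> \<le> n}\<close> being closed. The suprema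
  are finite because \<open>P = T\<^sup>\<sharp> T\<close> is symmetric for the semi-inner product: if \<open>A_norm A x = 1\<close>, then
  \<open>(A_norm A (P x)) ^ (2 ^ n)\<close> is at most \<open>A_norm A ((P ^^ (2 ^ n)) x)\<close>, which is bounded by a constant
  times the power \<open>2 ^ n\<close> of the operator norm of \<open>P\<close>.
\<close>

subsection \<open>Complex and semi-inner products\<close>

lemma cinner_add_right: "cinner x (y + z) = cinner x y + cinner x z"
  by (metis cinner_add_left cinner_commute complex_cnj_add)

lemma cinner_scaleC_right: "cinner x (c *\<^sub>C y) = cnj c * cinner x y"
  by (metis cinner_commute cinner_scaleC_left complex_cnj_mult)

lemma cinner_scaleR_left: "cinner (r *\<^sub>R x) y = complex_of_real r * cinner x y"
  by (simp add: scaleR_scaleC cinner_scaleC_left)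

lemma cinner_scaleR_right: "cinner x (r *\<^sub>R y) = complex_of_real r * cinner x y"
  by (simp add: scaleR_scaleC cinner_scaleC_right)

lemma cinner_minus_left: "cinner (- x) y = - cinner x y"
  using cinner_scaleR_left[of "-1" x y] by simp

lemma cinner_minus_right: "cinner x (- y) = - cinner x y"
  using cinner_scaleR_right[of x "-1" y] by simp

lemma cinner_diff_left: "cinner (x - y) z = cinner x z - cinner y z"
  using cinner_add_left[of x "- y" z] by (simp add: cinner_minus_left)

lemma cinner_diff_right: "cinner x (y - z) = cinner x y - cinner x z"
  using cinner_add_right[of x y "- z"] by (simp add: cinner_minus_right)

lemma cinner_zero_left [simp]: "cinner 0 x = 0"
  using cinner_diff_left[of x x x] by simp

lemma cinner_zero_right [simp]: "cinner x 0 = 0"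
  using cinner_diff_right[of x x x] by simp

lemma cinner_self: "cinner x x = complex_of_real ((norm x)\<^sup>2)"
proof -
  obtain r where "cinner x x = complex_of_real r" "0 \<le> r"
    using cinner_ge_zero[of x] by (auto elim: nonneg_Reals_cases)
  then show ?thesis by (simp add: norm_eq_sqrt_cinner)
qed

lemma bounded_clinear_add: "bounded_clinear T \<Longrightarrow> T (x + y) = T x + T y"
  by (simp add: bounded_clinear_def linear_simps)

lemma bounded_clinear_diff: "bounded_clinear T \<Longrightarrow> T (x - y) = T x - T y"
  by (simp add: bounded_clinear_def linear_simps)

lemma bounded_clinear_scaleC: "bounded_clinear T \<Longrightarrow> T (c *\<^sub>C x) = c *\<^sub>C T x"
  by (simp add: bounded_clinear_def)

lemma bounded_clinear_compose:
  "bounded_clinear S \<Longrightarrow> bounded_clinear T \<Longrightarrow> bounded_clinear (S \<circ> T)"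
  by (auto simp: bounded_clinear_def o_def intro: bounded_linear_compose)

text \<open>For \<open>b\<close> nonzero, evaluate at \<open>t = 1 / b\<close>; for
  \<open>b = 0\<close> an affine function that stays nonnegative has slope 0. The factor
  \<open>m\<close> in both terms fits perturbations by \<open>t * z\<close> with a complex
  \<open>z\<close> and \<open>m = (cmod z)^2\<close>, so that phases never have to be divided
  out.\<close>

lemma discriminant_le:
  fixes a b m :: real
  assumes "\<And>t. 0 \<le> a - 2 * t * m + t\<^sup>2 * m * b" and "0 \<le> a" "0 \<le> b" "0 \<le> m"
  shows "m \<le> a * b"
proof (cases "b = 0")
  case True
  show ?thesis
  proof (cases "m = 0")
    case False
    \<comment> \<open>At this \<open>t\<close> the expression equals -1, a contradiction.\<close>
    then show ?thesis using assms(1)[of "(a + 1) / (2 * m)"] True assms(2) by simp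
  qed (use assms in simp)
next
  case False
  then have "0 \<le> a - m / b"
    using assms(1)[of "1 / b"] by (simp add: power2_eq_square field_simps)
  then show ?thesis using False assms(3) by (simp add: field_simps)
qed

section \<open>The semi-inner product of a positive operator\<close>

locale positive_operator =
  fixes A :: "'a::complex_hilbert \<Rightarrow> 'a"
  assumes positive: "positive_op A"
begin

lemma clinear: "bounded_clinear A"
  using positive by (simp add: positive_op_def)

lemma blinear: "bounded_linear A"
  using clinear by (simp add: bounded_clinear_def)

lemma A_inner_add_left: "A_inner A (x + y) z = A_inner A x z + A_inner A y z"
  by (simp add: A_inner_def bounded_clinear_add[OF clinear] cinner_add_left)

lemma A_inner_add_right: "A_inner A x (y + z) = A_inner A x y + A_inner A x z"
  by (simp add: A_inner_def cinner_add_right)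

lemma A_inner_scaleC_left: "A_inner A (c *\<^sub>C x) z = c * A_inner A x z"
  by (simp add: A_inner_def bounded_clinear_scaleC[OF clinear] cinner_scaleC_left)

lemma A_inner_scaleC_right: "A_inner A x (c *\<^sub>C z) = cnj c * A_inner A x z"
  by (simp add: A_inner_def cinner_scaleC_right)

lemma A_inner_self: "A_inner A x x = complex_of_real ((A_norm A x)\<^sup>2)"
proof -
  obtain r where "cinner (A x) x = complex_of_real r" "0 \<le> r"
    using positive by (auto simp: positive_op_def elim: nonneg_Reals_cases)
  then show ?thesis by (simp add: A_norm_def A_inner_def)
qed

lemma A_norm_nonneg: "0 \<le> A_norm A x"
proof -
  have "0 \<le> Re (cinner (A x) x)"
    using positive by (metis complex_nonneg_Reals_iff positive_op_def)
  then show ?thesis by (simp add: A_norm_def A_inner_def)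
qed

text \<open>Polarization: the form is real at \<open>x + y\<close> and at \<open>x + i y\<close>.
  The first fact compares the imaginary parts of the two cross terms, the second their real parts.
  Hence positivity alone makes \<open>A\<close> self-adjoint.\<close>

lemma A_inner_commute: "A_inner A x y = cnj (A_inner A y x)"
proof -
  have "Im (A_inner A (x + y) (x + y)) = 0"
    by (simp add: A_inner_self)
  then have 1: "Im (A_inner A x y) + Im (A_inner A y x) = 0"
    unfolding A_inner_add_left A_inner_add_right by (simp add: A_inner_self)
  have "Im (A_inner A (x + \<i> *\<^sub>C y) (x + \<i> *\<^sub>C y)) = 0"
    by (simp add: A_inner_self)
  then have "Re (A_inner A x y) = Re (A_inner A y x)"
    unfolding A_inner_add_left A_inner_add_right A_inner_scaleC_left A_inner_scaleC_right
    by (simp add: A_inner_self)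
  with 1 show ?thesis by (simp add: complex_eq_iff)
qed

lemma selfadjoint: "cinner (A x) y = cinner x (A y)"
  using A_inner_commute[of x y] unfolding A_inner_def by (metis cinner_commute)

lemma A_norm_add_sq:
  "(A_norm A (x + y))\<^sup>2 = (A_norm A x)\<^sup>2 + (A_norm A y)\<^sup>2 + 2 * Re (A_inner A x y)"
proof -
  have "(A_norm A (x + y))\<^sup>2 = Re (A_inner A (x + y) (x + y))"
    by (simp add: A_inner_self)
  also have "\<dots> = (A_norm A x)\<^sup>2 + (A_norm A y)\<^sup>2 + (Re (A_inner A x y) + Re (A_inner A y x))"
    unfolding A_inner_add_left A_inner_add_right by (simp add: A_inner_self)
  finally show ?thesis using A_inner_commute[of x y] by simp
qed

lemma A_norm_scaleC: "A_norm A (c *\<^sub>C x) = cmod c * A_norm A x"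
proof -
  have "(A_norm A (c *\<^sub>C x))\<^sup>2 = Re (A_inner A (c *\<^sub>C x) (c *\<^sub>C x))"
    by (simp add: A_inner_self)
  also have "\<dots> = Re (c * cnj c) * (A_norm A x)\<^sup>2"
    unfolding A_inner_scaleC_left A_inner_scaleC_right
    by (simp add: A_inner_self algebra_simps)
  also have "\<dots> = (cmod c * A_norm A x)\<^sup>2"
    by (simp add: power_mult_distrib complex_norm_square[symmetric] del: of_real_power)
  finally show ?thesis by (simp add: A_norm_nonneg)
qed

text \<open>Cauchy-Schwarz for a seminorm: since \<open>A_norm A y\<close> may vanish for nonzero
  \<open>y\<close>, the discriminant bound replaces the usual division by it.\<close>

lemma cmod_A_inner_le: "cmod (A_inner A x y) \<le> A_norm A x * A_norm A y"
proof -
  define z where "z = A_inner A x y"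
  have "(cmod z)\<^sup>2 \<le> (A_norm A x)\<^sup>2 * (A_norm A y)\<^sup>2"
  proof (rule discriminant_le)
    fix t :: real
    \<comment> \<open>This phase makes the cross term with \<open>x\<close> real, namely
      \<open>- t * (cmod z)^2\<close>.\<close>
    define c where "c = - (complex_of_real t * z)"
    have "cnj c * z = complex_of_real (- t * (cmod z)\<^sup>2)"
      by (simp add: c_def complex_norm_square mult.commute del: of_real_power)
    then have "Re (A_inner A x (c *\<^sub>C y)) = - t * (cmod z)\<^sup>2"
      by (simp add: A_inner_scaleC_right flip: z_def)
    moreover have "(cmod c)\<^sup>2 = t\<^sup>2 * (cmod z)\<^sup>2"
      by (simp add: c_def norm_mult power_mult_distrib)
    ultimately have "(A_norm A (x + c *\<^sub>C y))\<^sup>2 =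
        (A_norm A x)\<^sup>2 - 2 * t * (cmod z)\<^sup>2 + t\<^sup>2 * (cmod z)\<^sup>2 * (A_norm A y)\<^sup>2"
      by (simp add: A_norm_add_sq A_norm_scaleC power_mult_distrib)
    then show "0 \<le> (A_norm A x)\<^sup>2 - 2 * t * (cmod z)\<^sup>2 + t\<^sup>2 * (cmod z)\<^sup>2 * (A_norm A y)\<^sup>2"
      by (metis zero_le_power2)
  qed auto
  then have "(cmod z)\<^sup>2 \<le> (A_norm A x * A_norm A y)\<^sup>2"
    by (simp add: power_mult_distrib)
  then show ?thesis
    unfolding z_def by (rule power2_le_imp_le) (simp add: A_norm_nonneg)
qed

end

text \<open>The identity is positive and its seminorm is the norm, so Cauchy-Schwarz and the
  expansion of squared norms carry over to the Hilbert space itself.\<close>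

interpretation id_op: positive_operator "\<lambda>x::'a::complex_hilbert. x"
  by unfold_locales (simp add: positive_op_def bounded_clinear_def cinner_ge_zero bounded_linear_ident)

lemma A_norm_id: "A_norm (\<lambda>x. x) x = norm (x::'a::complex_hilbert)"
  by (simp add: A_norm_def A_inner_def norm_eq_sqrt_cinner)

lemma cmod_cinner_le: "cmod (cinner x y) \<le> norm x * norm (y::'a::complex_hilbert)"
  using id_op.cmod_A_inner_le[of x y] by (simp add: A_norm_id A_inner_def)

lemma norm_add_sq:
  "(norm (x + y))\<^sup>2 = (norm x)\<^sup>2 + (norm y)\<^sup>2 + 2 * Re (cinner x (y::'a::complex_hilbert))"
  using id_op.A_norm_add_sq[of x y] by (simp add: A_norm_id A_inner_def)

lemma norm_scaleC: "norm (c *\<^sub>C x) = cmod c * norm (x::'a::complex_hilbert)"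
  using id_op.A_norm_scaleC[of c x] by (simp add: A_norm_id)

lemma bounded_bilinear_cinner:
  "bounded_bilinear (cinner :: 'a::complex_hilbert \<Rightarrow> 'a \<Rightarrow> complex)"
proof
  show "\<exists>K. \<forall>a b::'a. cmod (cinner a b) \<le> norm a * norm b * K"
    by (rule exI[of _ 1]) (simp add: cmod_cinner_le)
qed (simp_all add: cinner_add_left cinner_add_right cinner_scaleR_left cinner_scaleR_right
      scaleR_conv_of_real)

lemma parallelogram:
  "(norm (x + y))\<^sup>2 + (norm (x - y))\<^sup>2 = 2 * (norm x)\<^sup>2 + 2 * (norm (y::'a::complex_hilbert))\<^sup>2"
  using norm_add_sq[of x y] norm_add_sq[of x "- y"] by (simp add: cinner_minus_right)

subsection \<open>Hilbert space theory\<close>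

text \<open>The sublevel sets cover a complete space, so by Baire one of them contains a ball.
  Subtracting the value at its centre moves the bound to a ball about 0, at the cost of a factor
  2.\<close>

lemma bounded_linear_if_closed_sublevels:
  fixes f :: "'a::banach \<Rightarrow> 'b::real_normed_vector"
  assumes "linear f" and closed: "\<And>n::nat. closed {x. norm (f x) \<le> real n}"
  shows "bounded_linear f"
proof -
  interpret linear f by fact
  have "\<exists>n::nat. interior {x. norm (f x) \<le> real n} \<noteq> {}"
  proof (rule ccontr)
    assume "\<not> ?thesis"
    then have "euclidean interior_of (\<Union>n::nat. {x. norm (f x) \<le> real n}) = {}"
      using closed
      by (intro Baire_category_alt) (auto intro: completely_metrizable_space_euclidean)
    moreover have "(\<Union>n::nat. {x. norm (f x) \<le> real n}) = UNIV"
      using real_arch_simple by auto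
    ultimately show False by simp
  qed
  then obtain n :: nat and a where "a \<in> interior {x. norm (f x) \<le> real n}" by blast
  then obtain e where "0 < e" and e: "cball a e \<subseteq> {x. norm (f x) \<le> real n}"
    by (meson mem_interior_cball)
  have "norm (f x) \<le> norm x * (2 * real n / e)" for x
  proof (cases "x = 0")
    case False
    define y where "y = a + (e / norm x) *\<^sub>R x"
    have "y \<in> cball a e" using False \<open>0 < e\<close> by (simp add: y_def dist_norm)
    moreover have "a \<in> cball a e" using \<open>0 < e\<close> by simp
    ultimately have "norm (f y) \<le> n" "norm (f a) \<le> n" using e by blast+
    then have "norm (f y - f a) \<le> 2 * real n"
      using norm_triangle_ineq4[of "f y" "f a"] by linarith
    also have "f y - f a = (e / norm x) *\<^sub>R f x" by (simp add: y_def add scaleR)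
    finally show ?thesis using False \<open>0 < e\<close> by (simp add: field_simps)
  qed (simp add: zero)
  then show ?thesis using bounded_linear_intro[OF add scaleR] by blast
qed

lemma continuous_on_cinner [continuous_intros]:
  fixes f g :: "'b::topological_space \<Rightarrow> 'a::complex_hilbert"
  assumes "continuous_on S f" "continuous_on S g"
  shows "continuous_on S (\<lambda>x. cinner (f x) (g x))"
  using bounded_bilinear.continuous_on[OF bounded_bilinear_cinner assms] .

lemma cinner_extensionality:
  assumes "\<And>x. cinner x y = cinner x z"
  shows "y = z"
  using assms[of "y - z"] cinner_eq_zero_iff[of "y - z"] by (simp add: cinner_diff_right)

text \<open>A minimizing sequence for the distance from \<open>x\<close> to \<open>M\<close> is
  Cauchy by the parallelogram law; its limit \<open>p\<close> is a nearest point, and varying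
  \<open>p\<close> inside \<open>M\<close> gives orthogonality.\<close>

lemma orthogonal_projection_exists:
  fixes M :: "'a::complex_hilbert set"
  assumes "closed M" "0 \<in> M"
    and add: "\<And>x y. x \<in> M \<Longrightarrow> y \<in> M \<Longrightarrow> x + y \<in> M"
    and scale: "\<And>c x. x \<in> M \<Longrightarrow> c *\<^sub>C x \<in> M"
  obtains p where "p \<in> M" "\<And>m. m \<in> M \<Longrightarrow> cinner (x - p) m = 0"
proof -
  define d where "d = (INF m\<in>M. (norm (x - m))\<^sup>2)"
  have bdd: "bdd_below ((\<lambda>m. (norm (x - m))\<^sup>2) ` M)"
    by (rule bdd_belowI2[of _ 0]) simp
  have d_le: "d \<le> (norm (x - m))\<^sup>2" if "m \<in> M" for m
    unfolding d_def using bdd that by (rule cINF_lower)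
  have "\<exists>m\<in>M. (norm (x - m))\<^sup>2 < d + 1 / Suc n" for n
    using cINF_less_iff[OF _ bdd, of "d + 1 / Suc n"] \<open>0 \<in> M\<close> by (auto simp: d_def)
  then obtain m where m: "\<And>n. m n \<in> M" "\<And>n. (norm (x - m n))\<^sup>2 < d + 1 / Suc n"
    by metis
  have gap: "(norm (m k - m n))\<^sup>2 \<le> 2 / Suc k + 2 / Suc n" for k n
  proof -
    \<comment> \<open>The midpoint stays in \<open>M\<close>, so its squared distance to
      \<open>x\<close> is at least \<open>d\<close>; this bounds the sum term of the parallelogram
      law from below by \<open>4 * d\<close>.\<close>
    define h where "h = (1/2) *\<^sub>R (m k + m n)"
    have "h \<in> M" unfolding h_def scaleR_scaleC by (intro scale add m)
    have "(x - m k) + (x - m n) = 2 *\<^sub>R (x - h)"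
      by (simp add: h_def scaleR_diff_right scaleR_2)
    then have "(norm ((x - m k) + (x - m n)))\<^sup>2 = 4 * (norm (x - h))\<^sup>2"
      by (simp add: power_mult_distrib)
    then have "4 * d \<le> (norm ((x - m k) + (x - m n)))\<^sup>2"
      using d_le[OF \<open>h \<in> M\<close>] by simp
    moreover have "(x - m k) - (x - m n) = - (m k - m n)" by simp
    ultimately show ?thesis
      using parallelogram[of "x - m k" "x - m n"] m(2)[of k] m(2)[of n]
      by (simp only: norm_minus_cancel)
  qed
  have "Cauchy m"
  proof (rule CauchyI)
    fix e :: real assume "0 < e"
    then obtain N where N: "inverse (Suc N) < e\<^sup>2 / 4"
      using reals_Archimedean[of "e\<^sup>2 / 4"] by auto
    have *: "1 / Suc k \<le> inverse (Suc N)" if "N \<le> k" for k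
      using that by (simp add: field_simps)
    have "norm (m k - m n) < e" if "N \<le> k" "N \<le> n" for k n
    proof (rule power2_less_imp_less)
      show "(norm (m k - m n))\<^sup>2 < e\<^sup>2"
        using gap[of k n] *[OF that(1)] *[OF that(2)] N by argo
    qed (use \<open>0 < e\<close> in simp)
    then show "\<exists>M. \<forall>k\<ge>M. \<forall>n\<ge>M. norm (m k - m n) < e" by blast
  qed
  then obtain p where p: "m \<longlonglongrightarrow> p" using Cauchy_convergent convergent_def by blast
  have "p \<in> M" using \<open>closed M\<close> m(1) p by (rule closed_sequentially)
  have "(norm (x - p))\<^sup>2 \<le> d"
  proof (rule LIMSEQ_le)
    show "(\<lambda>n. (norm (x - m n))\<^sup>2) \<longlonglongrightarrow> (norm (x - p))\<^sup>2" by (intro tendsto_intros p)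
    show "(\<lambda>n. d + 1 / Suc n) \<longlonglongrightarrow> d"
      using tendsto_add[OF tendsto_const LIMSEQ_inverse_real_of_nat, of d]
      by (simp add: inverse_eq_divide)
  qed (use m(2) less_imp_le in blast)
  have "cinner (x - p) y = 0" if "y \<in> M" for y
  proof -
    define z where "z = cinner (x - p) y"
    \<comment> \<open>The constant term is 0 because minimality of \<open>p\<close> cancels
      \<open>(norm (x - p))^2\<close> on both sides.\<close>
    have "(cmod z)\<^sup>2 \<le> 0 * (norm y)\<^sup>2"
    proof (rule discriminant_le)
      fix t :: real
      define c where "c = complex_of_real t * z"
      have "p + c *\<^sub>C y \<in> M" by (intro add scale that \<open>p \<in> M\<close>)
      then have "(norm (x - p))\<^sup>2 \<le> (norm (x - (p + c *\<^sub>C y)))\<^sup>2"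
        using d_le \<open>(norm (x - p))\<^sup>2 \<le> d\<close> order_trans by blast
      also have "x - (p + c *\<^sub>C y) = (x - p) + - (c *\<^sub>C y)" by simp
      finally have "0 \<le> (norm (c *\<^sub>C y))\<^sup>2 - 2 * Re (cnj c * z)"
        unfolding norm_add_sq by (simp add: cinner_minus_right cinner_scaleC_right z_def)
      moreover have "Re (cnj c * z) = t * (cmod z)\<^sup>2"
      proof -
        have "cnj c * z = complex_of_real (t * (cmod z)\<^sup>2)"
          by (simp add: c_def complex_norm_square mult.commute del: of_real_power)
        then show ?thesis by (simp only: Re_complex_of_real)
      qed
      ultimately show "0 \<le> 0 - 2 * t * (cmod z)\<^sup>2 + t\<^sup>2 * (cmod z)\<^sup>2 * (norm y)\<^sup>2"
        by (simp add: norm_scaleC c_def norm_mult power_mult_distrib)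
    qed auto
    then show ?thesis by (simp add: z_def)
  qed
  with \<open>p \<in> M\<close> show thesis using that by blast
qed

section \<open>Riesz representation and adjoints\<close>

lemma riesz_representation:
  fixes f :: "'a::complex_hilbert \<Rightarrow> complex"
  assumes "bounded_linear f" and homogeneous: "\<And>c x. f (c *\<^sub>C x) = c * f x"
  obtains y where "\<And>x. f x = cinner x y"
proof (cases "\<forall>x. f x = 0")
  case True
  then show thesis using that[of 0] by simp
next
  case False
  then obtain a where "f a \<noteq> 0" by blast
  interpret bounded_linear f by fact
  have "closed {x. f x = 0}"
    by (intro closed_Collect_eq linear_continuous_on continuous_intros) fact
  then obtain p where "f p = 0" and orth: "\<And>m. f m = 0 \<Longrightarrow> cinner (a - p) m = 0"
    by (rule orthogonal_projection_exists[where x = a]) (auto simp: add homogeneous zero)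
  \<comment> \<open>Removing from \<open>a\<close> its projection to the kernel leaves a vector
    orthogonal to the kernel on which \<open>f\<close> does not vanish.\<close>
  define u where "u = a - p"
  have "f u \<noteq> 0" using \<open>f a \<noteq> 0\<close> \<open>f p = 0\<close> by (simp add: u_def diff)
  then have "cinner u u \<noteq> 0" using zero by (auto simp: cinner_eq_zero_iff)
  have "f x = cinner x (cnj (f u / cinner u u) *\<^sub>C u)" for x
  proof -
    \<comment> \<open>The kernel has codimension one: this combination lies in it, hence is
      orthogonal to \<open>u\<close>, and the resulting equation is solved for
      \<open>f x\<close>.\<close>
    have "f (x - (f x / f u) *\<^sub>C u) = 0" using \<open>f u \<noteq> 0\<close> by (simp add: diff homogeneous)
    then have "cinner (x - (f x / f u) *\<^sub>C u) u = 0"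
      using orth cinner_commute[of _ u] by (simp add: u_def)
    then show ?thesis using \<open>f u \<noteq> 0\<close> \<open>cinner u u \<noteq> 0\<close>
      by (simp add: cinner_diff_left cinner_scaleC_left cinner_scaleC_right field_simps)
  qed
  then show thesis by (rule that)
qed

lemma adjoint_exists:
  fixes T :: "'a::complex_hilbert \<Rightarrow> 'a"
  assumes "bounded_clinear T"
  obtains X where "bounded_clinear X" "\<And>x y. cinner (T x) y = cinner x (X y)"
proof -
  have "\<exists>z. \<forall>x. cinner (T x) y = cinner x z" for y
  proof (rule riesz_representation[of "\<lambda>x. cinner (T x) y"])
    show "bounded_linear (\<lambda>x. cinner (T x) y)"
      using assms unfolding bounded_clinear_def
      by (intro bounded_linear_compose[OF
            bounded_bilinear.bounded_linear_left[OF bounded_bilinear_cinner]]) auto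
  qed (auto simp: bounded_clinear_scaleC[OF assms] cinner_scaleC_left)
  then obtain X where X: "\<And>x y. cinner (T x) y = cinner x (X y)" by metis
  obtain K where K: "\<And>x. norm (T x) \<le> norm x * K"
    using assms bounded_linear.bounded unfolding bounded_clinear_def by blast
  have add: "X (y + z) = X y + X z" for y z
    by (rule cinner_extensionality) (simp add: cinner_add_right flip: X)
  have scale: "X (c *\<^sub>C y) = c *\<^sub>C X y" for c y
    by (rule cinner_extensionality) (simp add: cinner_scaleC_right flip: X)
  have bound: "norm (X y) \<le> norm y * K" for y
  proof (cases "X y = 0")
    case True
    \<comment> \<open>The sign of \<open>K\<close> is not given, so nonnegativity is read off from
      the bound on \<open>T y\<close>.\<close>
    have "0 \<le> norm y * K" using order_trans[OF norm_ge_zero K[of y]] .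
    then show ?thesis using True by simp
  next
    case False
    have "(norm (X y))\<^sup>2 = cmod (cinner (T (X y)) y)"
      by (simp add: X cinner_self norm_power)
    also have "\<dots> \<le> norm (X y) * K * norm y"
      using order_trans[OF cmod_cinner_le mult_right_mono[OF K norm_ge_zero]] .
    finally show ?thesis using False by (simp add: power2_eq_square mult_ac)
  qed
  have "bounded_linear X"
    by (rule bounded_linear_intro[OF add _ bound]) (simp add: scaleR_scaleC scale)
  then have "bounded_clinear X"
    by (simp add: bounded_clinear_def scale)
  then show thesis using X by (rule that)
qed

text \<open>The definite description is proper: Riesz gives existence, and an operator is determined
  by its inner products with all vectors.\<close>

lemma cadjoint:
  fixes T :: "'a::complex_hilbert \<Rightarrow> 'a"
  assumes "bounded_clinear T"
  shows bounded_clinear_cadjoint: "bounded_clinear (cadjoint T)"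
    and cinner_cadjoint_right: "cinner x (cadjoint T y) = cinner (T x) y"
proof -
  obtain X where X: "bounded_clinear X" "\<And>x y. cinner (T x) y = cinner x (X y)"
    using adjoint_exists[OF assms] by blast
  have "Y = X" if "\<forall>x y. cinner (T x) y = cinner x (Y y)" for Y
  proof
    fix y
    show "Y y = X y" by (rule cinner_extensionality) (simp add: that[rule_format, symmetric] X(2))
  qed
  then have "cadjoint T = X"
    unfolding cadjoint_def using X by (intro the_equality) auto
  then show "bounded_clinear (cadjoint T)" "cinner x (cadjoint T y) = cinner (T x) y"
    using X by auto
qed

lemma cinner_cadjoint_left:
  fixes T :: "'a::complex_hilbert \<Rightarrow> 'a"
  assumes "bounded_clinear T"
  shows "cinner (cadjoint T x) y = cinner x (T y)"
  using cinner_cadjoint_right[OF assms, of y x] cinner_commute[of "cadjoint T x" y]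
    cinner_commute[of x "T y"] by simp

subsection \<open>The reduced solution of Douglas\<close>

lemma bounded_linear_scaleC: "bounded_linear (\<lambda>x::'a::complex_hilbert. c *\<^sub>C x)"
  by (rule bounded_linear_intro[where K = "cmod c"])
    (simp_all add: scaleC_add_right scaleR_scaleC scaleC_scaleC norm_scaleC mult.commute)

context positive_operator
begin

lemma subspace_range: "subspace (range A)"
  by (rule linear_subspace_image[OF bounded_linear.linear[OF blinear] subspace_UNIV])

lemma closure_range_add:
  assumes "x \<in> closure (range A)" "y \<in> closure (range A)"
  shows "x + y \<in> closure (range A)"
proof -
  obtain f g where "\<And>n. f n \<in> range A" "f \<longlonglongrightarrow> x" "\<And>n. g n \<in> range A" "g \<longlonglongrightarrow> y"
    using assms unfolding closure_sequential by blast
  then have "\<And>n. f n + g n \<in> range A" "(\<lambda>n. f n + g n) \<longlonglongrightarrow> x + y"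
    by (auto intro: subspace_add[OF subspace_range] tendsto_add)
  then show ?thesis
    unfolding closure_sequential by (intro exI[of _ "\<lambda>n. f n + g n"]) simp
qed

lemma closure_range_scaleC:
  assumes "x \<in> closure (range A)"
  shows "c *\<^sub>C x \<in> closure (range A)"
proof -
  have "(\<lambda>x. c *\<^sub>C x) ` closure (range A) \<subseteq> closure (range A)"
  proof (rule image_closure_subset)
    show "continuous_on (closure (range A)) (\<lambda>x. c *\<^sub>C x)"
      by (rule linear_continuous_on[OF bounded_linear_scaleC])
    have "c *\<^sub>C A x \<in> range A" for x
      using bounded_clinear_scaleC[OF clinear, of c x] rangeI[of A "c *\<^sub>C x"] by simp
    then show "(\<lambda>x. c *\<^sub>C x) ` range A \<subseteq> closure (range A)"
      using closure_subset by blast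
  qed simp
  with assms show ?thesis by blast
qed

lemma closure_range_diff:
  assumes "x \<in> closure (range A)" "y \<in> closure (range A)"
  shows "x - y \<in> closure (range A)"
proof -
  have "x + (- 1) *\<^sub>C y = x - y" using scaleR_scaleC[of "- 1" y] by simp
  then show ?thesis
    using closure_range_add[OF assms(1) closure_range_scaleC[OF assms(2), of "- 1"]] by simp
qed

text \<open>By continuity the estimate passes from vectors \<open>A w\<close> to their limits, in
  particular to \<open>z\<close> itself, where it reads
  \<open>(norm z)^2 \<le> c * norm z\<close>.\<close>

lemma norm_le_on_closure_range:
  assumes "z \<in> closure (range A)" "\<And>w. cmod (cinner z (A w)) \<le> c * norm (A w)" "0 \<le> c"
  shows "norm z \<le> c"
proof -
  have "closed {v. cmod (cinner z v) \<le> c * norm v}"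
    by (intro closed_Collect_le continuous_intros
        continuous_on_cinner[OF continuous_on_const continuous_on_id])
  then have "closure (range A) \<subseteq> {v. cmod (cinner z v) \<le> c * norm v}"
    using assms(2) by (intro closure_minimal) auto
  then have "norm z * norm z \<le> c * norm z"
    using assms(1) by (auto simp: cinner_self norm_power power2_eq_square norm_mult)
  then show ?thesis using \<open>0 \<le> c\<close> by (cases "z = 0") auto
qed

lemma inj_on_closure_range: "inj_on A (closure (range A))"
proof (rule inj_onI)
  fix x y assume xy: "x \<in> closure (range A)" "y \<in> closure (range A)" "A x = A y"
  have "norm (x - y) \<le> 0"
  proof (rule norm_le_on_closure_range)
    show "x - y \<in> closure (range A)" using xy closure_range_diff by blast
    \<comment> \<open>Moving \<open>A\<close> to the left turns the inner product into that of
      \<open>A (x - y) = 0\<close> with \<open>w\<close>.\<close>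
    show "cmod (cinner (x - y) (A w)) \<le> 0 * norm (A w)" for w
      using xy(3) by (simp add: selfadjoint[symmetric] bounded_clinear_diff[OF clinear])
  qed simp
  then show "x = y" by simp
qed

text \<open>Projecting \<open>x\<close> to the closure of the range does not change
  \<open>A x\<close>: the remainder is orthogonal to the range, so the self-adjoint \<open>A\<close>
  annihilates it.\<close>

lemma range_eq_image_closure_range: "range A = A ` closure (range A)"
proof -
  have "A x \<in> A ` closure (range A)" for x
  proof -
    obtain p where p: "p \<in> closure (range A)"
      and orth: "\<And>m. m \<in> closure (range A) \<Longrightarrow> cinner (x - p) m = 0"
    proof (rule orthogonal_projection_exists[where x = x, OF closed_closure])
      show "0 \<in> closure (range A)"
        by (rule subsetD[OF closure_subset subspace_0[OF subspace_range]])
    qed (auto intro: closure_range_add closure_range_scaleC)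
    have "A (x - p) = 0"
    proof (rule cinner_extensionality)
      fix y
      have "A y \<in> closure (range A)" by (rule subsetD[OF closure_subset rangeI])
      then have "cinner (A (x - p)) y = 0" using orth selfadjoint by simp
      then show "cinner y (A (x - p)) = cinner y 0"
        using cinner_commute[of y "A (x - p)"] by simp
    qed
    then have "A x = A p" by (simp add: bounded_clinear_diff[OF clinear])
    then show ?thesis using p by blast
  qed
  then show ?thesis by auto
qed

text \<open>\<open>X y\<close> is the preimage of \<open>cadjoint T (A y)\<close> in the closure of
  the range; injectivity of \<open>A\<close> there yields linearity, and Baire yields
  boundedness.\<close>

lemma sharp_exists:
  assumes T: "bounded_clinear T" and range: "range (cadjoint T \<circ> A) \<subseteq> range A"
  obtains X where "bounded_clinear X" "A \<circ> X = cadjoint T \<circ> A"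
    "range X \<subseteq> closure (range A)"
proof -
  note adj = bounded_clinear_cadjoint[OF T]
  have "\<exists>z\<in>closure (range A). A z = cadjoint T (A y)" for y
  proof -
    have "cadjoint T (A y) \<in> A ` closure (range A)"
      using range range_eq_image_closure_range by auto
    then show ?thesis by force
  qed
  then obtain X where X: "\<And>y. X y \<in> closure (range A)" "\<And>y. A (X y) = cadjoint T (A y)"
    by metis
  have add: "X (x + y) = X x + X y" for x y
    by (rule inj_onD[OF inj_on_closure_range])
      (auto simp: X bounded_clinear_add[OF clinear] bounded_clinear_add[OF adj]
        intro: closure_range_add)
  have scale: "X (c *\<^sub>C x) = c *\<^sub>C X x" for c x
    by (rule inj_onD[OF inj_on_closure_range])
      (auto simp: X bounded_clinear_scaleC[OF clinear] bounded_clinear_scaleC[OF adj]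
        intro: closure_range_scaleC)
  have weak: "cinner (X y) (A w) = cinner (A y) (T w)" for y w
    by (simp add: selfadjoint[symmetric] X cinner_cadjoint_left[OF T])
  have "bounded_linear X"
  proof (rule bounded_linear_if_closed_sublevels)
    show "linear X" by (rule linearI) (simp_all add: add scale scaleR_scaleC)
    fix n :: nat
    \<comment> \<open>The norm of \<open>X y\<close> is tested against vectors \<open>A w\<close>
      only, and \<open>weak\<close> then eliminates \<open>X\<close>. What remains is a family of
      conditions continuous in \<open>y\<close>, so the sublevel set is closed.\<close>
    have "norm (X y) \<le> n \<longleftrightarrow> (\<forall>w. cmod (cinner (A y) (T w)) \<le> real n * norm (A w))" for y
    proof
      assume "norm (X y) \<le> n"
      then show "\<forall>w. cmod (cinner (A y) (T w)) \<le> real n * norm (A w)"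
        unfolding weak[symmetric]
        by (meson cmod_cinner_le mult_right_mono norm_ge_zero order_trans)
    qed (use norm_le_on_closure_range X(1) in \<open>simp add: weak\<close>)
    then have "{y. norm (X y) \<le> n} = (\<Inter>w. {y. cmod (cinner (A y) (T w)) \<le> real n * norm (A w)})"
      by auto
    also have "closed \<dots>"
      using linear_continuous_on[OF blinear]
      by (intro closed_INT ballI closed_Collect_le continuous_intros)
    finally show "closed {y. norm (X y) \<le> n}" .
  qed
  then have "bounded_clinear X" by (simp add: bounded_clinear_def scale)
  then show thesis using that X by (fastforce simp: fun_eq_iff)
qed

lemma A_sharp:
  assumes "T \<in> A_bounded_ops A"
  shows bounded_clinear_A_sharp: "bounded_clinear (A_sharp A T)"
    and A_inner_A_sharp_left: "A_inner A (A_sharp A T x) y = A_inner A x (T y)"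
proof -
  have T: "bounded_clinear T" "range (cadjoint T \<circ> A) \<subseteq> range A"
    using assms by (auto simp: A_bounded_ops_def)
  obtain X where X: "bounded_clinear X" "A \<circ> X = cadjoint T \<circ> A"
      "range X \<subseteq> closure (range A)"
    by (rule sharp_exists[OF T])
  have "Y = X" if "A \<circ> Y = cadjoint T \<circ> A" "range Y \<subseteq> closure (range A)" for Y
  proof
    fix x
    have "A (Y x) = A (X x)" using fun_cong[OF that(1), of x] fun_cong[OF X(2), of x] by simp
    then show "Y x = X x"
      by (rule inj_onD[OF inj_on_closure_range]) (rule subsetD[OF _ rangeI], fact that X)+
  qed
  then have "A_sharp A T = X"
    unfolding A_sharp_def by (intro the_equality conjI X) (elim conjE)
  with X show "bounded_clinear (A_sharp A T)" by simp
  have "A (A_sharp A T x) = cadjoint T (A x)"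
    using fun_cong[OF X(2), of x] \<open>A_sharp A T = X\<close> by simp
  then show "A_inner A (A_sharp A T x) y = A_inner A x (T y)"
    by (simp add: A_inner_def cinner_cadjoint_left[OF T(1)])
qed

end

subsection \<open>Bounds for the seminorms\<close>

text \<open>Lagrange's identity with weights 1, 1, 2, which are those of the Frobenius product of
  symmetric 2 by 2 matrices, whose off-diagonal entry counts twice.\<close>

lemma real_cauchy_schwarz_3:
  fixes x y z u v w :: real
  shows "(x * u + y * v + 2 * (z * w))\<^sup>2
    \<le> (x\<^sup>2 + y\<^sup>2 + 2 * z\<^sup>2) * (u\<^sup>2 + v\<^sup>2 + 2 * w\<^sup>2)"
proof -
  have "(x\<^sup>2 + y\<^sup>2 + 2 * z\<^sup>2) * (u\<^sup>2 + v\<^sup>2 + 2 * w\<^sup>2)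
      = (x * u + y * v + 2 * (z * w))\<^sup>2
        + (x * v - y * u)\<^sup>2 + 2 * (x * w - z * u)\<^sup>2 + 2 * (y * w - z * v)\<^sup>2"
    by (simp add: power2_eq_square algebra_simps)
  then show ?thesis by simp
qed

lemma le_if_exp_powers_le:
  fixes a c C :: real
  assumes "0 < c" "\<And>n. a ^ (2 ^ n) \<le> C * c ^ (2 ^ n)"
  shows "a \<le> c"
proof (rule ccontr)
  assume "\<not> a \<le> c"
  then have "1 < a / c" using assms(1) by simp
  then obtain n where "C < (a / c) ^ n" using real_arch_pow by blast
  \<comment> \<open>Uses \<open>n \<le> 2 ^ n\<close> and a base above 1.\<close>
  also have "\<dots> \<le> (a / c) ^ (2 ^ n)"
    using \<open>1 < a / c\<close> by (intro power_increasing) (auto simp: less_imp_le)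
  also have "\<dots> \<le> C"
    using assms by (simp add: power_divide field_simps)
  finally show False by simp
qed

context positive_operator
begin

lemma A_norm_le_norm:
  obtains K where "\<And>x. A_norm A x \<le> K * norm x"
proof -
  obtain L where L: "0 < L" "\<And>x. norm (A x) \<le> norm x * L"
    using bounded_linear.pos_bounded[OF blinear] by blast
  have "A_norm A x \<le> sqrt L * norm x" for x
  proof (rule power2_le_imp_le)
    have "(A_norm A x)\<^sup>2 = cmod (cinner (A x) x)"
      using A_inner_self[of x] by (simp add: A_inner_def norm_power)
    also have "\<dots> \<le> norm x * L * norm x"
      using order_trans[OF cmod_cinner_le mult_right_mono[OF L(2) norm_ge_zero]] .
    also have "\<dots> = (sqrt L * norm x)\<^sup>2"
      using L(1) by (simp add: power2_eq_square)
    finally show "(A_norm A x)\<^sup>2 \<le> (sqrt L * norm x)\<^sup>2" .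
  qed (use L(1) in simp)
  then show thesis by (rule that)
qed

lemma A_inner_funpow:
  assumes "\<And>x y. A_inner A (P x) y = A_inner A x (P y)"
  shows "A_inner A ((P ^^ m) x) y = A_inner A x ((P ^^ m) y)"
  by (induction m arbitrary: x y) (simp_all add: assms funpow_swap1)

text \<open>Repeated squaring postpones the comparison of seminorm and norm to a high power of
  \<open>P\<close>. The comparison costs a factor that does not depend on the power, so it
  disappears in the limit.\<close>

lemma A_symmetric_bounded:
  assumes P: "bounded_clinear P" and sym: "\<And>x y. A_inner A (P x) y = A_inner A x (P y)"
  obtains c where "\<And>x. A_norm A x = 1 \<Longrightarrow> A_norm A (P x) \<le> c"
proof -
  obtain K where K: "\<And>x. A_norm A x \<le> K * norm x" using A_norm_le_norm by blast
  obtain c where c: "0 < c" "\<And>x. norm (P x) \<le> norm x * c"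
    using P bounded_linear.pos_bounded unfolding bounded_clinear_def by blast
  have pow: "norm ((P ^^ m) x) \<le> norm x * c ^ m" for m x
  proof (induction m)
    case (Suc m)
    show ?case using order_trans[OF c(2) mult_right_mono[OF Suc]] c(1) by (simp add: mult_ac)
  qed simp
  have "A_norm A (P x) \<le> c" if x: "A_norm A x = 1" for x
  proof (rule le_if_exp_powers_le[OF c(1)])
    have square: "(A_norm A ((P ^^ m) x))\<^sup>2 \<le> A_norm A ((P ^^ (m + m)) x)" for m
    proof -
      have "(A_norm A ((P ^^ m) x))\<^sup>2 = cmod (A_inner A ((P ^^ m) x) ((P ^^ m) x))"
        using A_inner_self by (simp add: norm_power)
      also have "\<dots> = cmod (A_inner A x ((P ^^ (m + m)) x))"
        by (simp add: A_inner_funpow[OF sym] funpow_add)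
      finally show ?thesis using cmod_A_inner_le[of x "(P ^^ (m + m)) x"] x by simp
    qed
    fix n
    have "A_norm A (P x) ^ (2 ^ n) \<le> A_norm A ((P ^^ (2 ^ n)) x)"
    proof (induction n)
      case (Suc n)
      have "A_norm A (P x) ^ (2 ^ Suc n) = (A_norm A (P x) ^ (2 ^ n))\<^sup>2"
        by (simp add: power_mult[symmetric] mult.commute)
      also have "\<dots> \<le> (A_norm A ((P ^^ (2 ^ n)) x))\<^sup>2"
        by (intro power_mono Suc zero_le_power A_norm_nonneg)
      also note square
      finally show ?case by (simp add: mult_2)
    qed simp
    also have "\<dots> \<le> \<bar>K\<bar> * (norm x * c ^ (2 ^ n))"
    proof -
      have "A_norm A ((P ^^ (2 ^ n)) x) \<le> \<bar>K\<bar> * norm ((P ^^ (2 ^ n)) x)"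
        by (rule order_trans[OF K]) (simp add: mult_right_mono)
      also have "\<dots> \<le> \<bar>K\<bar> * (norm x * c ^ (2 ^ n))"
        by (intro mult_left_mono pow) simp
      finally show ?thesis .
    qed
    finally show "A_norm A (P x) ^ (2 ^ n) \<le> \<bar>K\<bar> * norm x * c ^ (2 ^ n)"
      by (simp add: mult.assoc)
  qed
  then show thesis by (rule that)
qed

text \<open>\<open>(A_norm A (T x))^2\<close> is the semi-inner product of \<open>?P x\<close> with
  \<open>x\<close>, and \<open>?P\<close> is symmetric, so the bound for symmetric operators
  applies.\<close>

lemma bdd_above_A_opnorm:
  assumes T: "T \<in> A_bounded_ops A"
  shows "bdd_above ((\<lambda>x. A_norm A (T x)) ` {x. A_norm A x = 1})"
proof -
  let ?P = "A_sharp A T \<circ> T"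
  have P: "bounded_clinear ?P"
    using T by (intro bounded_clinear_compose bounded_clinear_A_sharp) (auto simp: A_bounded_ops_def)
  have left: "A_inner A (?P x) y = A_inner A (T x) (T y)" for x y
    by (simp add: A_inner_A_sharp_left[OF T])
  have right: "A_inner A x (?P y) = A_inner A (T x) (T y)" for x y
    using left[of y x] A_inner_commute[of x "?P y"] A_inner_commute[of "T x" "T y"] by simp
  obtain c where c: "\<And>x. A_norm A x = 1 \<Longrightarrow> A_norm A (?P x) \<le> c"
    using A_symmetric_bounded[OF P] left right by metis
  have "A_norm A (T x) \<le> sqrt c" if "A_norm A x = 1" for x
  proof (rule real_le_rsqrt)
    have "(A_norm A (T x))\<^sup>2 = cmod (A_inner A (?P x) x)"
      using left[of x x] A_inner_self[of "T x"] by (simp add: norm_power)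
    also have "\<dots> \<le> c"
      using cmod_A_inner_le[of "?P x" x] c[OF that] that by simp
    finally show "(A_norm A (T x))\<^sup>2 \<le> c" .
  qed
  then show ?thesis by (intro bdd_aboveI2) simp
qed

lemma A_norm_le_A_opnorm:
  assumes "T \<in> A_bounded_ops A" "A_norm A x = 1"
  shows "A_norm A (T x) \<le> A_opnorm A T"
  unfolding A_opnorm_def using assms by (intro cSUP_upper bdd_above_A_opnorm) auto

text \<open>
  With \<open>v = cnj (A_inner a e) a + cnj (A_inner b e) b\<close>, the left-hand sum is \<open>A_inner v e\<close>,
  hence at most the seminorm of \<open>v\<close>.
\<close>

lemma A_bessel_two:
  assumes e: "A_norm A e = 1"
  shows "((cmod (A_inner A a e))\<^sup>2 + (cmod (A_inner A b e))\<^sup>2)\<^sup>2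
    \<le> A_norm A a ^ 4 + A_norm A b ^ 4 + 2 * (cmod (A_inner A a b))\<^sup>2"
    (is "?Q\<^sup>2 \<le> ?N")
proof -
  define \<alpha> \<beta> v where "\<alpha> = A_inner A a e" and "\<beta> = A_inner A b e"
    and "v = cnj \<alpha> *\<^sub>C a + cnj \<beta> *\<^sub>C b"
  define p q r where "p = cmod \<alpha>" and "q = cmod \<beta>" and "r = cmod (A_inner A a b)"
  have Q: "?Q = p\<^sup>2 + q\<^sup>2" by (simp add: p_def q_def \<alpha>_def \<beta>_def)
  have "A_inner A v e = complex_of_real ?Q"
    by (simp add: v_def A_inner_add_left A_inner_scaleC_left \<alpha>_def \<beta>_def
        complex_norm_square mult.commute del: of_real_power)
  then have "cmod (A_inner A v e) = ?Q" by (simp only: norm_of_real) simp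
  then have "?Q \<le> A_norm A v" using cmod_A_inner_le[of v e] e by simp
  then have "?Q\<^sup>2 \<le> (A_norm A v)\<^sup>2" by (rule power_mono) simp
  also have "\<dots> = p\<^sup>2 * (A_norm A a)\<^sup>2 + q\<^sup>2 * (A_norm A b)\<^sup>2 + 2 * Re (cnj \<alpha> * \<beta> * A_inner A a b)"
    by (simp add: v_def A_norm_add_sq A_norm_scaleC power_mult_distrib p_def q_def
        A_inner_scaleC_left A_inner_scaleC_right mult_ac)
  also have "\<dots> \<le> p\<^sup>2 * (A_norm A a)\<^sup>2 + q\<^sup>2 * (A_norm A b)\<^sup>2 + 2 * (p * q * r)"
    using complex_Re_le_cmod[of "cnj \<alpha> * \<beta> * A_inner A a b"]
    by (simp add: norm_mult p_def q_def r_def)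
  finally have "(?Q\<^sup>2)\<^sup>2 \<le> (p\<^sup>2 * (A_norm A a)\<^sup>2 + q\<^sup>2 * (A_norm A b)\<^sup>2 + 2 * (p * q * r))\<^sup>2"
    by (rule power_mono) simp
  \<comment> \<open>The triple \<open>p^2\<close>, \<open>q^2\<close>, \<open>p * q\<close> is
    paired with the Gram entries. Its weighted square sum is \<open>(p^2 + q^2)^2\<close>, so one
    factor \<open>?Q^2\<close> can be cancelled afterwards.\<close>
  also have "\<dots> \<le> ((p\<^sup>2)\<^sup>2 + (q\<^sup>2)\<^sup>2 + 2 * (p * q)\<^sup>2)
      * (((A_norm A a)\<^sup>2)\<^sup>2 + ((A_norm A b)\<^sup>2)\<^sup>2 + 2 * r\<^sup>2)"
    by (rule real_cauchy_schwarz_3)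
  also have "\<dots> = ?Q\<^sup>2 * ?N"
    unfolding Q r_def by (simp add: power2_eq_square power4_eq_xxxx algebra_simps)
  finally have "?Q\<^sup>2 * ?Q\<^sup>2 \<le> ?Q\<^sup>2 * ?N" by (simp add: power2_eq_square)
  then show ?thesis
  proof (cases "?Q\<^sup>2 = 0")
    case False
    then have "0 < ?Q\<^sup>2" by simp
    with \<open>?Q\<^sup>2 * ?Q\<^sup>2 \<le> ?Q\<^sup>2 * ?N\<close> show ?thesis
      by (rule mult_left_le_imp_le)
  qed simp
qed

text \<open>If \<open>A_norm A y = 0\<close>, Cauchy-Schwarz against \<open>A y\<close> forces
  \<open>A y = 0\<close>; any other \<open>y\<close> can be normalized. This makes the index set of
  the suprema nonempty.\<close>

lemma exists_A_norm_one:
  assumes "A \<noteq> (\<lambda>x. 0)"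
  obtains x where "A_norm A x = 1"
proof -
  obtain y where "A y \<noteq> 0" using assms by blast
  have "A_norm A y \<noteq> 0"
  proof
    assume "A_norm A y = 0"
    then have "A_inner A y (A y) = 0" using cmod_A_inner_le[of y "A y"] by simp
    then show False using \<open>A y \<noteq> 0\<close> by (simp add: A_inner_def cinner_eq_zero_iff)
  qed
  then have "A_norm A (complex_of_real (1 / A_norm A y) *\<^sub>C y) = 1"
    unfolding A_norm_scaleC norm_of_real using A_norm_nonneg[of y] by simp
  then show thesis by (rule that)
qed

end

theorem theorem2p1:
  fixes A T S :: "'a::complex_hilbert \<Rightarrow> 'a"
  assumes "positive_op A" and "A \<noteq> (\<lambda>x. 0)"
    and "T \<in> A_bounded_ops A" and "S \<in> A_bounded_ops A"
  shows "(A_euclidean_radius A T S)\<^sup>2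
           \<le> sqrt (A_opnorm A T ^ 4 + A_opnorm A S ^ 4 + 2 * (A_numradius A (A_sharp A S \<circ> T))\<^sup>2)
       \<and> sqrt (A_opnorm A T ^ 4 + A_opnorm A S ^ 4 + 2 * (A_numradius A (A_sharp A S \<circ> T))\<^sup>2)
           \<le> (A_opnorm A T)\<^sup>2 + (A_opnorm A S)\<^sup>2"
proof -
  interpret positive_operator A by unfold_locales fact
  define t s w where "t = A_opnorm A T" and "s = A_opnorm A S"
    and "w = A_numradius A (A_sharp A S \<circ> T)"
  let ?N = "t ^ 4 + s ^ 4 + 2 * w\<^sup>2"
  obtain x0 where x0: "A_norm A x0 = 1" using exists_A_norm_one[OF assms(2)] by blast
  have T: "A_norm A (T x) \<le> t" and S: "A_norm A (S x) \<le> s" if "A_norm A x = 1" for x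
    using A_norm_le_A_opnorm assms(3,4) that by (auto simp: t_def s_def)
  have "0 \<le> t" "0 \<le> s"
    using order_trans[OF A_norm_nonneg T[OF x0]] order_trans[OF A_norm_nonneg S[OF x0]] by auto
  \<comment> \<open>This turns the numerical radius into a supremum over the off-diagonal Gram
    entry.\<close>
  have sharp: "A_inner A ((A_sharp A S \<circ> T) x) x = A_inner A (T x) (S x)" for x
    by (simp add: A_inner_A_sharp_left[OF assms(4)])
  have TS: "cmod (A_inner A (T x) (S x)) \<le> t * s" if "A_norm A x = 1" for x
    by (rule order_trans[OF cmod_A_inner_le])
      (intro mult_mono T S that A_norm_nonneg \<open>0 \<le> t\<close>)
  have w: "cmod (A_inner A (T x) (S x)) \<le> w" if "A_norm A x = 1" for x
    unfolding w_def A_numradius_def sharp using that TS by (intro cSUP_upper bdd_aboveI2) auto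
  have "w \<le> t * s"
    unfolding w_def A_numradius_def sharp using x0 TS by (intro cSUP_least) auto
  have "0 \<le> w" using order_trans[OF norm_ge_zero w[OF x0]] .
  \<comment> \<open>The fourth root appears because the Euclidean radius is a supremum of square
    roots, whereas the Bessel-type estimate bounds the square of the radicand.\<close>
  have bound: "sqrt ((cmod (A_inner A (T x) x))\<^sup>2 + (cmod (A_inner A (S x) x))\<^sup>2) \<le> sqrt (sqrt ?N)"
    if x: "A_norm A x = 1" for x
  proof (intro real_sqrt_le_mono real_le_rsqrt)
    note A_bessel_two[OF x, of "T x" "S x"]
    also have "A_norm A (T x) ^ 4 + A_norm A (S x) ^ 4 + 2 * (cmod (A_inner A (T x) (S x)))\<^sup>2 \<le> ?N"
      by (intro add_mono mult_left_mono power_mono T S w x A_norm_nonneg norm_ge_zero) simp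
    finally show "((cmod (A_inner A (T x) x))\<^sup>2 + (cmod (A_inner A (S x) x))\<^sup>2)\<^sup>2 \<le> ?N" .
  qed
  have "A_euclidean_radius A T S \<le> sqrt (sqrt ?N)"
    unfolding A_euclidean_radius_def using x0 bound by (intro cSUP_least) auto
  \<comment> \<open>One member of the family shows that the supremum is nonnegative, as squaring its
    upper bound requires.\<close>
  moreover have "sqrt ((cmod (A_inner A (T x0) x0))\<^sup>2 + (cmod (A_inner A (S x0) x0))\<^sup>2)
      \<le> A_euclidean_radius A T S"
    unfolding A_euclidean_radius_def using x0
    by (intro cSUP_upper bdd_aboveI2[where M = "sqrt (sqrt ?N)"] bound) auto
  then have "0 \<le> A_euclidean_radius A T S"
    by (rule order_trans[rotated]) simp
  ultimately have "(A_euclidean_radius A T S)\<^sup>2 \<le> (sqrt (sqrt ?N))\<^sup>2"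
    by (rule power_mono)
  then have first: "(A_euclidean_radius A T S)\<^sup>2 \<le> sqrt ?N"
    by simp
  have "w\<^sup>2 \<le> (t * s)\<^sup>2" using \<open>w \<le> t * s\<close> \<open>0 \<le> w\<close> by (rule power_mono)
  \<comment> \<open>Replacing \<open>w\<close> by \<open>t * s\<close> completes the square.\<close>
  then have "?N \<le> (t\<^sup>2 + s\<^sup>2)\<^sup>2"
    by (simp add: power2_sum power_mult_distrib)
  then have "sqrt ?N \<le> t\<^sup>2 + s\<^sup>2" by (rule real_le_lsqrt[rotated]) simp
  with first show ?thesis by (simp add: t_def s_def w_def)
qed

end
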